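(* Let $n\ge 1$ and $m\ge 1$ be integers. Let $F:\mathbb{R}^n\to\mathbb{R}^n$ be a sufficiently differentiable function in a neighbourhood $D\subset\mathbb{R}^n$ of a point $\alpha$ such that $F(\alpha)=0$, and assume that $F'(\alpha)$ is nonsingular. Let $H:\mathbb{R}^{n\times n}\to\mathbb{R}^{n\times n}$ be a weight function (in the sense described in the context) that satisfies $H(I)=I$, $H_1=-1$ and $\|H''(I)\|<\infty$. Then, for all real parameters $\beta\neq 0$ and $\delta\neq 0$, taking an initial estimate $x^{(0)}$ close enough to $\alpha$, the sequence of iterates $\{x^{(k)}\}_{k\ge 0}$ generated by the $m$-step method $SW_m$ with weight function $H$ and parameters $\beta,\delta$ converges to $\alpha$ with order $2m$.
   Context: Divided differences: for $x,h\in\mathbb{R}^n$ such that the segment from $x$ to $x+h$ lies in $D$, the first-order divided difference operator of $F$ is the $n\times n$ matrix $$[x+h,x;F]=\int_0^1 F'(x+th)\,dt,$$ so that $[y,x;F]=\int_0^1F'(x+t(y-x))\,dt$. Weight function: let $X=\mathbb{R}^{n\times n}$ be the Banach space of real $n\times n$ matrices and $I$ the identity matrix. A weight function is a differentiable map $H:X\to X$ whose first and second Fréchet derivatives at $I$ act as multiplication by real constants, $H'(I)(v)=H_1v$ and $H''(I)(v,w)=H_2vw$ with $H_1,H_2\in\mathbb{R}$, in the sense that, as $t\to I$, $$H(t)=H(I)+H_1(t-I)+\tfrac12H_2(t-I)^2+O\left((t-I)^3\right).$$ Method $SW_m$: given $x^{(0)}$ and real parameters $\beta,\delta$, for $k=0,1,2,\dots$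 put $$w^{(k)}=x^{(k)}+\beta F(x^{(k)}),\qquad z_1^{(k)}=x^{(k)}-[w^{(k)},x^{(k)};F]^{-1}F(x^{(k)}),$$ $$v^{(k)}=z_1^{(k)}+\delta F(z_1^{(k)}),\qquad t^{(k)}=[w^{(k)},x^{(k)};F]^{-1}[z_1^{(k)},v^{(k)};F],$$ $$z_j^{(k)}=z_{j-1}^{(k)}-H(t^{(k)})[w^{(k)},x^{(k)};F]^{-1}F(z_{j-1}^{(k)}),\qquad j=2,\dots,m,$$ and $x^{(k+1)}=z_m^{(k)}$ (for $m=1$ the method is just $x^{(k+1)}=z_1^{(k)}$). Order of convergence: with $e_k=x^{(k)}-\alpha$, convergence with order $p$ (here $p=2m$) is understood as an error equation $e_{k+1}=K e_k^{p}+O(e_k^{p+1})$, where $K e_k^p$ denotes a $p$-linear map, depending only on $F$, $\alpha$, $H$ and the parameters, evaluated at $(e_k,\dots,e_k)$ (the map is not required to be nonzero); in particular $\|e_{k+1}\|\le C\|e_k\|^{p}$ for some constant $C$. *)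

theory Defs
  imports "HOL-Analysis.Analysis" "HOL-Library.Landau_Symbols"
begin

(* C^r on an open subset S of a Euclidean space, by recursion on the
   directional derivatives (in finite dimension this is the usual notion). *)
primrec C_times_on ::
  "nat \<Rightarrow> 'a::euclidean_space set \<Rightarrow> ('a \<Rightarrow> 'b::euclidean_space) \<Rightarrow> bool" where
  "C_times_on 0 S f \<longleftrightarrow> continuous_on S f"
| "C_times_on (Suc r) S f \<longleftrightarrow>
     (\<forall>x\<in>S. f differentiable (at x)) \<and>
     (\<forall>v. C_times_on r S (\<lambda>x. frechet_derivative f (at x) v))"

(* [y, x; F].  The value is meaningful only when the segment from x to y lies in
   the domain where F is continuously differentiable. *)
definition divided_difference ::
  "real^'n \<Rightarrow> real^'n \<Rightarrow> (real^'n \<Rightarrow> real^'n) \<Rightarrow> real^'n^'n" where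
  "divided_difference y x F =
     integral {0..1} (\<lambda>t::real. jacobian F (at (x + t *\<^sub>R (y - x))))"

(* H' is the Frechet derivative of H, and H'' the Frechet derivative of H' at the
   identity.  Products of matrices are written with **, since * on vectors is
   componentwise.  "H''(I)(v,w) = H2 v w" is required on the diagonal v = w only, as in
   the quadratic term of the expansion: a second Frechet derivative is symmetric, so
   demanding H2 v w for all v and w would force H2 = 0 as soon as n > 1. *)
definition weight_function ::
  "(real^'n^'n \<Rightarrow> real^'n^'n) \<Rightarrow> real \<Rightarrow> real \<Rightarrow> bool" where
  "weight_function H H1 H2 \<longleftrightarrow>
     (\<exists>(H' :: real^'n^'n \<Rightarrow> (real^'n^'n) \<Rightarrow>\<^sub>L (real^'n^'n))
       (H'' :: real^'n^'n \<Rightarrow> (real^'n^'n) \<Rightarrow>\<^sub>L (real^'n^'n)).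
        (\<forall>t. (H has_derivative blinfun_apply (H' t)) (at t)) \<and>
        (H' has_derivative H'') (at (mat 1)) \<and>
        (\<forall>v. blinfun_apply (H' (mat 1)) v = H1 *\<^sub>R v) \<and>
        (\<forall>v. blinfun_apply (H'' v) v = H2 *\<^sub>R (v ** v))) \<and>
     (\<lambda>t. norm (H t - (H (mat 1) + H1 *\<^sub>R (t - mat 1)
                     + (H2 / 2) *\<^sub>R ((t - mat 1) ** (t - mat 1)))))
       \<in> O[at (mat 1)](\<lambda>t. norm (t - mat 1) ^ 3)"

definition SW_w :: "(real^'n \<Rightarrow> real^'n) \<Rightarrow> real \<Rightarrow> real^'n \<Rightarrow> real^'n" where
  "SW_w F \<beta> x = x + \<beta> *\<^sub>R F x"

definition SW_A :: "(real^'n \<Rightarrow> real^'n) \<Rightarrow> real \<Rightarrow> real^'n \<Rightarrow> real^'n^'n" where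
  "SW_A F \<beta> x = divided_difference (SW_w F \<beta> x) x F"

definition SW_z1 :: "(real^'n \<Rightarrow> real^'n) \<Rightarrow> real \<Rightarrow> real^'n \<Rightarrow> real^'n" where
  "SW_z1 F \<beta> x = x - matrix_inv (SW_A F \<beta> x) *v F x"

definition SW_v :: "(real^'n \<Rightarrow> real^'n) \<Rightarrow> real \<Rightarrow> real \<Rightarrow> real^'n \<Rightarrow> real^'n" where
  "SW_v F \<beta> \<delta> x = SW_z1 F \<beta> x + \<delta> *\<^sub>R F (SW_z1 F \<beta> x)"

definition SW_t :: "(real^'n \<Rightarrow> real^'n) \<Rightarrow> real \<Rightarrow> real \<Rightarrow> real^'n \<Rightarrow> real^'n^'n" where
  "SW_t F \<beta> \<delta> x =
     matrix_inv (SW_A F \<beta> x) ** divided_difference (SW_z1 F \<beta> x) (SW_v F \<beta> \<delta> x) F"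

(* z_j for j \<ge> 1 *)
definition SW_z ::
  "(real^'n \<Rightarrow> real^'n) \<Rightarrow> (real^'n^'n \<Rightarrow> real^'n^'n) \<Rightarrow> real \<Rightarrow> real \<Rightarrow> real^'n \<Rightarrow> nat \<Rightarrow> real^'n" where
  "SW_z F H \<beta> \<delta> x j =
     ((\<lambda>z. z - (H (SW_t F \<beta> \<delta> x) ** matrix_inv (SW_A F \<beta> x)) *v F z) ^^ (j - 1))
       (SW_z1 F \<beta> x)"

primrec SW ::
  "nat \<Rightarrow> (real^'n \<Rightarrow> real^'n) \<Rightarrow> (real^'n^'n \<Rightarrow> real^'n^'n) \<Rightarrow> real \<Rightarrow> real \<Rightarrow> real^'n \<Rightarrow> nat \<Rightarrow> real^'n" where
  "SW m F H \<beta> \<delta> x0 0 = x0"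
| "SW m F H \<beta> \<delta> x0 (Suc k) = SW_z F H \<beta> \<delta> (SW m F H \<beta> \<delta> x0 k) m"

(* One step from x makes sense: F is evaluated in D only, the segments of the divided
   differences lie in D, and the inverse exists (matrix_inv is total in HOL).
   The points v and t are not used when m = 1. *)
definition SW_step_defined ::
  "nat \<Rightarrow> (real^'n) set \<Rightarrow> (real^'n \<Rightarrow> real^'n) \<Rightarrow> (real^'n^'n \<Rightarrow> real^'n^'n) \<Rightarrow> real \<Rightarrow> real \<Rightarrow> real^'n \<Rightarrow> bool" where
  "SW_step_defined m D F H \<beta> \<delta> x \<longleftrightarrow>
     closed_segment x (SW_w F \<beta> x) \<subseteq> D \<and>
     invertible (SW_A F \<beta> x) \<and>
     (\<forall>j\<in>{1..m}. SW_z F H \<beta> \<delta> x j \<in> D) \<and>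
     (2 \<le> m \<longrightarrow> closed_segment (SW_v F \<beta> \<delta> x) (SW_z1 F \<beta> x) \<subseteq> D)"

(* p-linear maps; the p arguments are given as a list of length p *)
definition multilinear_map :: "nat \<Rightarrow> ('a::real_vector list \<Rightarrow> 'b::real_vector) \<Rightarrow> bool" where
  "multilinear_map p K \<longleftrightarrow>
     (\<forall>xs i. length xs = p \<longrightarrow> i < p \<longrightarrow> linear (\<lambda>v. K (xs[i := v])))"

(* X x0 k is the k-th iterate started at x0.  K and the constants are chosen before x0:
   the error equation is one and the same for all starting points near \<alpha>. *)
definition locally_converges_with_order ::
  "(('a::real_normed_vector) \<Rightarrow> nat \<Rightarrow> 'a) \<Rightarrow> 'a \<Rightarrow> nat \<Rightarrow> bool" where
  "locally_converges_with_order X \<alpha> p \<longleftrightarrow>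
     (\<exists>K B C. multilinear_map p K \<and>
        (\<forall>\<^sub>F x0 in nhds \<alpha>.
           X x0 \<longlonglongrightarrow> \<alpha> \<and>
           (\<forall>k. norm ((X x0 (Suc k) - \<alpha>) - K (replicate p (X x0 k - \<alpha>)))
                  \<le> B * norm (X x0 k - \<alpha>) ^ (p + 1)) \<and>
           (\<forall>k. norm (X x0 (Suc k) - \<alpha>) \<le> C * norm (X x0 k - \<alpha>) ^ p)))"

end

theory Submission
  imports Defs
begin

text \<open>
  The idea is that, near the zero \<open>\<alpha>\<close>, every substep of the method multiplies the error by a matrix that
  is itself small.  Let \<open>T\<close> be the jacobian at \<open>\<alpha>\<close>, \<open>e = x - \<alpha>\<close>, \<open>A\<close> the divided difference of \<open>w\<close> and
  \<open>x\<close>, and \<open>X\<close> its inverse.  By \<open>divided_difference_taylor\<close> the divided difference of two points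
  is \<open>T\<close> plus a linear term in their differences from \<open>\<alpha>\<close> plus a quadratic error, and by
  \<open>divided_difference_mult\<close> it turns \<open>F z\<close> into the product of the divided difference of \<open>z\<close> and \<open>\<alpha>\<close>
  with \<open>z - \<alpha>\<close>.

  The first substep is of Newton type: its error \<open>X (A - d) e\<close>, with \<open>d\<close> the divided difference of \<open>x\<close> and \<open>\<alpha>\<close>,
  has order 2 (\<open>has_leading_form_SW_z1\<close>).
  A later substep multiplies the error of \<open>z\<close> by \<open>mat 1 - H t ** X ** d\<close>, now with \<open>d\<close> the divided
  difference of \<open>z\<close> and \<open>\<alpha>\<close>.  The matrix \<open>t\<close> equals \<open>X ** d\<close> up to a term of order 2, because
  \<open>z\<close>, \<open>z1\<close> and \<open>v\<close> all agree with \<open>\<alpha>\<close> to second order, and \<open>t - mat 1\<close> has order 1.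
  As \<open>H t = mat 1 - (t - mat 1) + O(norm (t - mat 1) ^ 2)\<close> is an approximate inverse of \<open>t\<close>, the first order terms
  cancel and the factor has order 2 (\<open>has_leading_form_SW_step\<close>).  Hence \<open>z\<^sub>j\<close> has an error of order \<open>2 * j\<close>.

  An error equation asks for more than an order: the leading term has to be a multilinear map on the diagonal.
  The predicate \<open>has_leading_form\<close> records both.  It is preserved by sums, by linear maps and, with degrees
  adding up, by bilinear products, so the expansions above never have to compute a leading
  coefficient.  Finally, order at least 2 makes one step of the method a contraction near
  \<open>\<alpha>\<close>, which gives convergence and keeps all iterates where the local estimates hold
  (\<open>iterates_of_superlinear_map\<close>).
\<close>

section \<open>Functions vanishing to a given order\<close>

definition vanishes_to_order ::
  "'a::real_normed_vector \<Rightarrow> nat \<Rightarrow> ('a \<Rightarrow> 'b::real_normed_vector) \<Rightarrow> bool" where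
  "vanishes_to_order a p f \<longleftrightarrow> (\<exists>C. \<forall>\<^sub>F x in nhds a. norm (f x) \<le> C * norm (x - a) ^ p)"

lemma vanishes_to_orderI:
  "\<forall>\<^sub>F x in nhds a. norm (f x) \<le> C * norm (x - a) ^ p \<Longrightarrow> vanishes_to_order a p f"
  unfolding vanishes_to_order_def by blast

lemma vanishes_to_orderE:
  assumes "vanishes_to_order a p f"
  obtains C where "0 \<le> C" "\<forall>\<^sub>F x in nhds a. norm (f x) \<le> C * norm (x - a) ^ p"
proof -
  obtain C where C: "\<forall>\<^sub>F x in nhds a. norm (f x) \<le> C * norm (x - a) ^ p"
    using assms unfolding vanishes_to_order_def by blast
  have "\<forall>\<^sub>F x in nhds a. norm (f x) \<le> \<bar>C\<bar> * norm (x - a) ^ p"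
    using C by eventually_elim (meson abs_ge_self mult_right_mono norm_ge_zero order_trans zero_le_power)
  then show thesis using that[of "\<bar>C\<bar>"] by simp
qed

lemma vanishes_to_order_cong:
  assumes "vanishes_to_order a p f" "\<forall>\<^sub>F x in nhds a. f x = g x"
  shows "vanishes_to_order a p g"
proof -
  obtain C where C: "\<forall>\<^sub>F x in nhds a. norm (f x) \<le> C * norm (x - a) ^ p"
    using assms unfolding vanishes_to_order_def by blast
  have "\<forall>\<^sub>F x in nhds a. norm (g x) \<le> C * norm (x - a) ^ p"
    using C assms(2) by eventually_elim simp
  then show ?thesis by (rule vanishes_to_orderI)
qed

lemma vanishes_to_order_zero [simp, intro]: "vanishes_to_order a p (\<lambda>x. 0)"
  by (intro vanishes_to_orderI[of _ 0]) simp

lemma vanishes_to_order_add: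
  assumes "vanishes_to_order a p f" "vanishes_to_order a p g"
  shows "vanishes_to_order a p (\<lambda>x. f x + g x)"
proof -
  obtain C where C: "\<forall>\<^sub>F x in nhds a. norm (f x) \<le> C * norm (x - a) ^ p"
    using assms(1) vanishes_to_orderE by blast
  obtain C' where C': "\<forall>\<^sub>F x in nhds a. norm (g x) \<le> C' * norm (x - a) ^ p"
    using assms(2) vanishes_to_orderE by blast
  have "\<forall>\<^sub>F x in nhds a. norm (f x + g x) \<le> (C + C') * norm (x - a) ^ p"
    using C C' by eventually_elim (simp add: distrib_right norm_triangle_le)
  then show ?thesis by (rule vanishes_to_orderI)
qed

lemma vanishes_to_order_bounded_linear:
  assumes "bounded_linear L" "vanishes_to_order a p f"
  shows "vanishes_to_order a p (\<lambda>x. L (f x))"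
proof -
  obtain C where C: "\<forall>\<^sub>F x in nhds a. norm (f x) \<le> C * norm (x - a) ^ p"
    using assms(2) vanishes_to_orderE by blast
  obtain B where B: "\<And>y. norm (L y) \<le> norm y * B" "0 \<le> B"
    using bounded_linear.nonneg_bounded[OF assms(1)] by blast
  have "\<forall>\<^sub>F x in nhds a. norm (L (f x)) \<le> (C * B) * norm (x - a) ^ p"
    using C
  proof eventually_elim
    case (elim x)
    have "norm (L (f x)) \<le> norm (f x) * B" by (rule B)
    also have "\<dots> \<le> (C * norm (x - a) ^ p) * B" using elim B(2) by (rule mult_right_mono)
    finally show ?case by (simp add: mult_ac)
  qed
  then show ?thesis by (rule vanishes_to_orderI)
qed

lemma vanishes_to_order_diff:
  assumes "vanishes_to_order a p f" "vanishes_to_order a p g"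
  shows "vanishes_to_order a p (\<lambda>x. f x - g x)"
  using vanishes_to_order_add[OF assms(1) vanishes_to_order_bounded_linear[OF bounded_linear_minus[OF bounded_linear_ident] assms(2)]]
  by simp

lemma vanishes_to_order_sum:
  assumes "\<And>i. i \<in> S \<Longrightarrow> vanishes_to_order a p (f i)"
  shows "vanishes_to_order a p (\<lambda>x. \<Sum>i\<in>S. f i x)"
  using assms by (induction S rule: infinite_finite_induct) (auto intro: vanishes_to_order_add)

lemma vanishes_to_order_bounded_bilinear:
  assumes "bounded_bilinear h" "vanishes_to_order a p f" "vanishes_to_order a q g"
  shows "vanishes_to_order a (p + q) (\<lambda>x. h (f x) (g x))"
proof -
  obtain C where C: "0 \<le> C" "\<forall>\<^sub>F x in nhds a. norm (f x) \<le> C * norm (x - a) ^ p"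
    using assms(2) vanishes_to_orderE by blast
  obtain C' where C': "0 \<le> C'" "\<forall>\<^sub>F x in nhds a. norm (g x) \<le> C' * norm (x - a) ^ q"
    using assms(3) vanishes_to_orderE by blast
  obtain B where B: "\<And>y z. norm (h y z) \<le> norm y * norm z * B" "0 \<le> B"
    using bounded_bilinear.nonneg_bounded[OF assms(1)] by blast
  have "\<forall>\<^sub>F x in nhds a. norm (h (f x) (g x)) \<le> (C * C' * B) * norm (x - a) ^ (p + q)"
    using C(2) C'(2)
  proof eventually_elim
    case (elim x)
    have "norm (h (f x) (g x)) \<le> norm (f x) * norm (g x) * B" by (rule B)
    also have "\<dots> \<le> ((C * norm (x - a) ^ p) * (C' * norm (x - a) ^ q)) * B"
      using elim B(2) C(1) by (intro mult_right_mono mult_mono) auto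
    finally show ?case by (simp add: mult_ac power_add)
  qed
  then show ?thesis by (rule vanishes_to_orderI)
qed

lemma vanishes_to_order_weaken:
  assumes "vanishes_to_order a q f" "p \<le> q"
  shows "vanishes_to_order a p f"
proof -
  obtain C where C: "0 \<le> C" "\<forall>\<^sub>F x in nhds a. norm (f x) \<le> C * norm (x - a) ^ q"
    using assms(1) vanishes_to_orderE by blast
  have "\<forall>\<^sub>F x in nhds a. dist x a < 1" by (rule eventually_nhds_metric[THEN iffD2]) (auto intro: exI[of _ 1])
  with C(2) have "\<forall>\<^sub>F x in nhds a. norm (f x) \<le> C * norm (x - a) ^ p"
  proof eventually_elim
    case (elim x)
    have "norm (x - a) ^ q \<le> norm (x - a) ^ p"
      using elim(2) assms(2) by (intro power_decreasing) (auto simp: dist_norm)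
    then show ?case using elim(1) C(1) by (meson mult_left_mono order_trans)
  qed
  then show ?thesis by (rule vanishes_to_orderI)
qed

lemma tendsto_nhds_if_vanishes_to_order:
  assumes "vanishes_to_order a p (\<lambda>x. f x - b)" "1 \<le> p"
  shows "(f \<longlongrightarrow> b) (nhds a)"
proof -
  obtain C where C: "0 \<le> C" "\<forall>\<^sub>F x in nhds a. norm (f x - b) \<le> C * norm (x - a) ^ 1"
    using vanishes_to_orderE[OF vanishes_to_order_weaken[OF assms]] by blast
  have "((\<lambda>x. C * norm (x - a) ^ 1) \<longlongrightarrow> C * norm (a - a) ^ 1) (nhds a)"
    by (intro tendsto_intros) (simp add: filterlim_ident)
  then have "((\<lambda>x. f x - b) \<longlongrightarrow> 0) (nhds a)"
    by (intro Lim_null_comparison[OF C(2)]) simp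
  then show ?thesis by (rule LIM_zero_cancel)
qed

text \<open>Orders multiply under composition because the inner function tends to \<open>b\<close>, so that its values
  eventually enter the neighbourhood on which the bound for \<open>g\<close> holds.\<close>
lemma vanishes_to_order_compose:
  assumes "vanishes_to_order b q g" "vanishes_to_order a p (\<lambda>x. f x - b)" "1 \<le> p"
  shows "vanishes_to_order a (p * q) (\<lambda>x. g (f x))"
proof -
  obtain C where C: "0 \<le> C" "\<forall>\<^sub>F x in nhds a. norm (f x - b) \<le> C * norm (x - a) ^ p"
    using assms(2) vanishes_to_orderE by blast
  obtain C' where C': "0 \<le> C'" "\<forall>\<^sub>F y in nhds b. norm (g y) \<le> C' * norm (y - b) ^ q"
    using assms(1) vanishes_to_orderE by blast
  have "\<forall>\<^sub>F x in nhds a. norm (g (f x)) \<le> C' * norm (f x - b) ^ q"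
    using tendsto_nhds_if_vanishes_to_order[OF assms(2,3)] C'(2)
    unfolding filterlim_iff by blast
  with C(2) have "\<forall>\<^sub>F x in nhds a. norm (g (f x)) \<le> (C' * C ^ q) * norm (x - a) ^ (p * q)"
  proof eventually_elim
    case (elim x)
    have "norm (f x - b) ^ q \<le> (C * norm (x - a) ^ p) ^ q"
      using elim(1) by (intro power_mono) auto
    then have "C' * norm (f x - b) ^ q \<le> C' * (C * norm (x - a) ^ p) ^ q"
      using C'(1) by (rule mult_left_mono)
    with elim(2) show ?case by (simp add: power_mult_distrib power_mult mult.assoc)
  qed
  then show ?thesis by (rule vanishes_to_orderI)
qed

lemma vanishes_to_order_Pair:
  assumes "vanishes_to_order a p f" "vanishes_to_order a p g"
  shows "vanishes_to_order a p (\<lambda>x. (f x, g x))"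
proof -
  obtain C where C: "\<forall>\<^sub>F x in nhds a. norm (f x) \<le> C * norm (x - a) ^ p"
    using assms(1) vanishes_to_orderE by blast
  obtain C' where C': "\<forall>\<^sub>F x in nhds a. norm (g x) \<le> C' * norm (x - a) ^ p"
    using assms(2) vanishes_to_orderE by blast
  have "\<forall>\<^sub>F x in nhds a. norm (f x, g x) \<le> (C + C') * norm (x - a) ^ p"
    using C C'
  proof eventually_elim
    case (elim x)
    then show ?case using norm_Pair_le[of "f x" "g x"] by (simp add: distrib_right)
  qed
  then show ?thesis by (rule vanishes_to_orderI)
qed

lemma vanishes_to_order_linear:
  "bounded_linear L \<Longrightarrow> vanishes_to_order a 1 (\<lambda>x. L (x - a))"
  by (rule vanishes_to_order_bounded_linear, assumption, rule vanishes_to_orderI[of _ 1]) simp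

section \<open>Functions with a homogeneous leading term\<close>

text \<open>The map \<open>K\<close> is the \<open>p\<close>-linear map of an error equation.  Since \<open>multilinear_map\<close> carries no
  continuity, the order of \<open>f\<close> itself is part of the definition; it bounds the diagonal of \<open>K\<close>, which
  is all that products require.  The map \<open>K\<close> may be zero, hence a function that vanishes to order \<open>p + 1\<close>
  also has a leading form of degree \<open>p\<close>.\<close>
definition has_leading_form ::
  "'a::real_normed_vector \<Rightarrow> nat \<Rightarrow> ('a \<Rightarrow> 'b::real_normed_vector) \<Rightarrow> bool" where
  "has_leading_form a p f \<longleftrightarrow> vanishes_to_order a p f \<and>
     (\<exists>K. multilinear_map p K \<and>
          vanishes_to_order a (p + 1) (\<lambda>x. f x - K (replicate p (x - a))))"

lemma has_leading_formE:
  assumes "has_leading_form a p f"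
  obtains K where "multilinear_map p K" "vanishes_to_order a p f"
    "vanishes_to_order a (p + 1) (\<lambda>x. f x - K (replicate p (x - a)))"
    "vanishes_to_order a p (\<lambda>x. K (replicate p (x - a)))"
proof -
  obtain K where K: "multilinear_map p K" "vanishes_to_order a p f"
    "vanishes_to_order a (p + 1) (\<lambda>x. f x - K (replicate p (x - a)))"
    using assms unfolding has_leading_form_def by blast
  have "vanishes_to_order a p (\<lambda>x. f x - (f x - K (replicate p (x - a))))"
    by (intro vanishes_to_order_diff K vanishes_to_order_weaken[OF K(3)]) simp
  then show thesis using that[OF K] by simp
qed

lemma multilinear_map_zero: "multilinear_map p (\<lambda>xs. 0)"
  unfolding multilinear_map_def by (auto intro: linear_zero)

text \<open>This is how all higher order terms are discarded: relative to degree \<open>p\<close> they contribute the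
  zero form.\<close>
lemma has_leading_form_if_vanishes:
  assumes "vanishes_to_order a q f" "p < q"
  shows "has_leading_form a p f"
  unfolding has_leading_form_def
  using assms vanishes_to_order_weaken[OF assms(1)] multilinear_map_zero[of p]
  by (intro conjI exI[of _ "\<lambda>xs. 0"]) auto

lemma has_leading_form_zero: "has_leading_form a p (\<lambda>x. 0)"
  by (rule has_leading_form_if_vanishes[of _ "Suc p"]) auto

lemma has_leading_form_weaken:
  assumes "has_leading_form a q f" "p \<le> q"
  shows "has_leading_form a p f"
proof (cases "p = q")
  case False
  then show ?thesis using assms has_leading_form_if_vanishes[of a q f p]
    by (auto simp: has_leading_form_def)
qed (use assms in simp)

lemma has_leading_form_const: "has_leading_form a 0 (\<lambda>x. c)"
  unfolding has_leading_form_def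
proof (intro conjI exI[of _ "\<lambda>xs. c"])
  show "vanishes_to_order a 0 (\<lambda>x. c)"
    by (rule vanishes_to_orderI[of _ "norm c"]) simp
qed (simp_all add: multilinear_map_def)

lemma has_leading_form_linear:
  assumes "bounded_linear L"
  shows "has_leading_form a 1 (\<lambda>x. L (x - a))"
  unfolding has_leading_form_def
proof (intro conjI exI[of _ "\<lambda>xs. L (xs ! 0)"])
  show "multilinear_map 1 (\<lambda>xs. L (xs ! 0))"
    using bounded_linear.linear[OF assms] by (auto simp: multilinear_map_def)
qed (use vanishes_to_order_linear[OF assms] in simp_all)

lemma has_leading_form_cong:
  assumes "has_leading_form a p f" "\<forall>\<^sub>F x in nhds a. f x = g x"
  shows "has_leading_form a p g"
proof -
  obtain K where K: "multilinear_map p K" "vanishes_to_order a p f"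
    "vanishes_to_order a (p + 1) (\<lambda>x. f x - K (replicate p (x - a)))"
    using assms(1) unfolding has_leading_form_def by blast
  have "\<forall>\<^sub>F x in nhds a. f x - K (replicate p (x - a)) = g x - K (replicate p (x - a))"
    using assms(2) by eventually_elim simp
  then have "vanishes_to_order a (p + 1) (\<lambda>x. g x - K (replicate p (x - a)))"
    by (rule vanishes_to_order_cong[OF K(3)])
  then show ?thesis unfolding has_leading_form_def
    using K(1) vanishes_to_order_cong[OF K(2) assms(2)] by blast
qed

lemma has_leading_form_add:
  assumes "has_leading_form a p f" "has_leading_form a p g"
  shows "has_leading_form a p (\<lambda>x. f x + g x)"
proof -
  obtain K where K: "multilinear_map p K" "vanishes_to_order a p f"
    "vanishes_to_order a (p + 1) (\<lambda>x. f x - K (replicate p (x - a)))"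
    using assms(1) unfolding has_leading_form_def by blast
  obtain K' where K': "multilinear_map p K'" "vanishes_to_order a p g"
    "vanishes_to_order a (p + 1) (\<lambda>x. g x - K' (replicate p (x - a)))"
    using assms(2) unfolding has_leading_form_def by blast
  show ?thesis unfolding has_leading_form_def
  proof (intro conjI exI[of _ "\<lambda>xs. K xs + K' xs"])
    show "multilinear_map p (\<lambda>xs. K xs + K' xs)"
      using K(1) K'(1) unfolding multilinear_map_def by (auto intro: linear_compose_add)
    show "vanishes_to_order a p (\<lambda>x. f x + g x)"
      by (intro vanishes_to_order_add K K')
    show "vanishes_to_order a (p + 1)
        (\<lambda>x. f x + g x - (K (replicate p (x - a)) + K' (replicate p (x - a))))"
      using vanishes_to_order_add[OF K(3) K'(3)] by (simp add: algebra_simps)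
  qed
qed

lemma has_leading_form_bounded_linear:
  assumes L: "bounded_linear L" and "has_leading_form a p f"
  shows "has_leading_form a p (\<lambda>x. L (f x))"
proof -
  obtain K where K: "multilinear_map p K" "vanishes_to_order a p f"
    "vanishes_to_order a (p + 1) (\<lambda>x. f x - K (replicate p (x - a)))"
    using assms(2) unfolding has_leading_form_def by blast
  show ?thesis unfolding has_leading_form_def
  proof (intro conjI exI[of _ "\<lambda>xs. L (K xs)"])
    show "multilinear_map p (\<lambda>xs. L (K xs))"
      using K(1) linear_compose[OF _ bounded_linear.linear[OF L]]
      unfolding multilinear_map_def by (auto simp: o_def)
    show "vanishes_to_order a p (\<lambda>x. L (f x))"
      by (intro vanishes_to_order_bounded_linear[OF L] K)
    show "vanishes_to_order a (p + 1) (\<lambda>x. L (f x) - L (K (replicate p (x - a))))"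
      using vanishes_to_order_bounded_linear[OF L K(3)]
      by (simp add: linear_diff[OF bounded_linear.linear[OF L]])
  qed
qed

lemma has_leading_form_diff:
  assumes "has_leading_form a p f" "has_leading_form a p g"
  shows "has_leading_form a p (\<lambda>x. f x - g x)"
  using has_leading_form_add[OF assms(1) has_leading_form_bounded_linear[OF bounded_linear_minus[OF bounded_linear_ident] assms(2)]]
  by simp

text \<open>The first \<open>p\<close> arguments go to one factor and the last \<open>q\<close> to the other, so each argument occurs
  in exactly one factor.\<close>
lemma multilinear_map_bilinear:
  assumes h: "bounded_bilinear h" and K: "multilinear_map p K" and K': "multilinear_map q K'"
  shows "multilinear_map (p + q) (\<lambda>xs. h (K (take p xs)) (K' (drop p xs)))"
  unfolding multilinear_map_def
proof (intro allI impI)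
  fix xs :: "'d list" and i
  assume len: "length xs = p + q" and i: "i < p + q"
  show "linear (\<lambda>v. h (K (take p (xs[i := v]))) (K' (drop p (xs[i := v]))))"
  proof (cases "i < p")
    case True
    then have "linear (\<lambda>v. K ((take p xs)[i := v]))"
      using K len unfolding multilinear_map_def by simp
    from linear_compose[OF this bounded_linear.linear[OF bounded_bilinear.bounded_linear_left[OF h]]]
    show ?thesis using True by (simp add: o_def take_update_swap)
  next
    case False
    then have "linear (\<lambda>v. K' ((drop p xs)[i - p := v]))"
      using K' len i unfolding multilinear_map_def by simp
    from linear_compose[OF this bounded_linear.linear[OF bounded_bilinear.bounded_linear_right[OF h]]]
    show ?thesis using False by (simp add: o_def drop_update_swap)
  qed
qed

text \<open>With leading terms \<open>k\<close> and \<open>k'\<close> the error of the product is \<open>h (f - k) g + h k (g - k')\<close>, and both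
  summands gain one order over \<open>p + q\<close>.\<close>
lemma has_leading_form_bounded_bilinear:
  assumes h: "bounded_bilinear h" and "has_leading_form a p f" "has_leading_form a q g"
  shows "has_leading_form a (p + q) (\<lambda>x. h (f x) (g x))"
proof -
  obtain K where K: "multilinear_map p K" "vanishes_to_order a p f"
    "vanishes_to_order a (p + 1) (\<lambda>x. f x - K (replicate p (x - a)))"
    "vanishes_to_order a p (\<lambda>x. K (replicate p (x - a)))"
    using assms(2) by (rule has_leading_formE)
  obtain K' where K': "multilinear_map q K'" "vanishes_to_order a q g"
    "vanishes_to_order a (q + 1) (\<lambda>x. g x - K' (replicate q (x - a)))"
    using assms(3) by (rule has_leading_formE)
  show ?thesis unfolding has_leading_form_def
  proof (intro conjI exI[of _ "\<lambda>xs. h (K (take p xs)) (K' (drop p xs))"])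
    show "multilinear_map (p + q) (\<lambda>xs. h (K (take p xs)) (K' (drop p xs)))"
      by (rule multilinear_map_bilinear[OF h K(1) K'(1)])
    show "vanishes_to_order a (p + q) (\<lambda>x. h (f x) (g x))"
      by (rule vanishes_to_order_bounded_bilinear[OF h K(2) K'(2)])
    have "vanishes_to_order a (p + q + 1)
        (\<lambda>x. h (f x - K (replicate p (x - a))) (g x)
           + h (K (replicate p (x - a))) (g x - K' (replicate q (x - a))))"
      using vanishes_to_order_bounded_bilinear[OF h K(3) K'(2)]
        vanishes_to_order_bounded_bilinear[OF h K(4) K'(3)]
      by (intro vanishes_to_order_add) (simp_all add: add_ac)
    then show "vanishes_to_order a (p + q + 1)
        (\<lambda>x. h (f x) (g x) - h (K (take p (replicate (p + q) (x - a))))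
                             (K' (drop p (replicate (p + q) (x - a)))))"
      by (simp add: bounded_bilinear.diff_left[OF h] bounded_bilinear.diff_right[OF h])
  qed
qed

lemma has_leading_form_shift:
  assumes "has_leading_form a p (\<lambda>x. f x - c)"
  shows "has_leading_form a 0 f"
  using has_leading_form_add[OF has_leading_form_weaken[OF assms le0] has_leading_form_const[of a c]]
  by simp

lemma has_leading_form_id: "has_leading_form a 1 (\<lambda>x. x - a)"
  using has_leading_form_linear[OF bounded_linear_ident] .

lemma has_leading_form_tendsto:
  assumes "has_leading_form a p (\<lambda>x. f x - c)" "1 \<le> p"
  shows "(f \<longlongrightarrow> c) (nhds a)"
  using assms tendsto_nhds_if_vanishes_to_order by (auto simp: has_leading_form_def)

section \<open>Iterating a superlinearly contracting map\<close>

text \<open>Order at least two makes \<open>\<phi>\<close> halve the distance to \<open>a\<close> on a small ball.  The ball is thus invariant,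
  so a property that holds near \<open>a\<close> holds along the whole orbit.\<close>
lemma iterates_of_superlinear_map:
  assumes "vanishes_to_order a p (\<lambda>x. \<phi> x - a)" "2 \<le> p" "\<forall>\<^sub>F x in nhds a. P x"
  shows "\<forall>\<^sub>F x in nhds a. (\<lambda>k. (\<phi> ^^ k) x) \<longlonglongrightarrow> a \<and> (\<forall>k. P ((\<phi> ^^ k) x))"
proof -
  obtain C where C: "0 \<le> C" "\<forall>\<^sub>F x in nhds a. norm (\<phi> x - a) \<le> C * norm (x - a) ^ 2"
    using vanishes_to_orderE[OF vanishes_to_order_weaken[OF assms(1,2)]] by blast
  from eventually_conj[OF C(2) assms(3)] obtain r where r: "0 < r"
    "\<And>x. dist x a < r \<Longrightarrow> norm (\<phi> x - a) \<le> C * norm (x - a) ^ 2 \<and> P x"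
    unfolding eventually_nhds_metric by blast
  \<comment> \<open>Then \<open>C * s \<le> 1/2\<close>, which turns the quadratic bound into a contraction by one half; the summand
    \<open>1\<close> covers \<open>C = 0\<close>.\<close>
  define s where "s = min r (1 / (2 * (C + 1)))"
  have s: "0 < s" "s \<le> r" "s \<le> 1 / (2 * (C + 1))" using r(1) C(1) by (auto simp: s_def)
  have contr: "norm (\<phi> x - a) \<le> norm (x - a) / 2" if "norm (x - a) < s" for x
  proof -
    have "C * norm (x - a) \<le> C * (1 / (2 * (C + 1)))"
      using that s C(1) by (intro mult_left_mono) auto
    also have "\<dots> \<le> 1/2" using C(1) by (simp add: field_simps)
    finally have "(C * norm (x - a)) * norm (x - a) \<le> 1/2 * norm (x - a)"
      by (rule mult_right_mono) simp
    moreover have "norm (\<phi> x - a) \<le> C * norm (x - a) ^ 2"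
      using r(2)[of x] that s by (auto simp: dist_norm)
    ultimately show ?thesis by (simp add: power2_eq_square mult_ac)
  qed
  have "(\<lambda>k. (\<phi> ^^ k) x) \<longlonglongrightarrow> a \<and> (\<forall>k. P ((\<phi> ^^ k) x))" if x: "norm (x - a) < s" for x
  proof -
    have bd: "norm ((\<phi> ^^ k) x - a) \<le> (1/2) ^ k * norm (x - a)" for k
    proof (induction k)
      case (Suc k)
      have "(1/2) ^ k * norm (x - a) \<le> 1 * norm (x - a)"
        by (intro mult_right_mono power_le_one) auto
      then have "norm (\<phi> ((\<phi> ^^ k) x) - a) \<le> norm ((\<phi> ^^ k) x - a) / 2"
        using Suc x by (intro contr) simp
      then show ?case using Suc by simp
    qed simp
    have near: "norm ((\<phi> ^^ k) x - a) < s" for k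
    proof -
      have "(1/2) ^ k * norm (x - a) \<le> 1 * norm (x - a)"
        by (intro mult_right_mono power_le_one) auto
      then show ?thesis using bd[of k] x by simp
    qed
    then have P: "P ((\<phi> ^^ k) x)" for k 
    proof -
      have "dist ((\<phi> ^^ k) x) a < r"
        using near[of k] s(2) unfolding dist_norm by linarith
      then show ?thesis using r(2) by blast
    qed
    have "(\<lambda>k. (1/2) ^ k * norm (x - a)) \<longlonglongrightarrow> 0 * norm (x - a)"
      by (intro tendsto_intros LIMSEQ_power_zero) auto
    then have lim: "(\<lambda>k. (1/2) ^ k * norm (x - a)) \<longlonglongrightarrow> 0"
      by (simp only: mult_zero_left)
    have "(\<lambda>k. (\<phi> ^^ k) x - a) \<longlonglongrightarrow> 0"
      by (rule Lim_null_comparison[OF always_eventually lim]) (blast intro: bd)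
    then show ?thesis using P by (simp add: LIM_zero_cancel)
  qed
  then show ?thesis unfolding eventually_nhds_metric dist_norm using s(1) by blast
qed

section \<open>Taylor expansion and matrix inversion\<close>

lemma vanishes_to_order_differentiable:
  assumes "f differentiable (at a)"
  shows "vanishes_to_order a 1 (\<lambda>x. f x - f a)"
proof -
  from assms obtain f' where f': "(f has_derivative f') (at a)" unfolding differentiable_def by blast
  have bl: "bounded_linear f'" using f' by (rule has_derivative_bounded_linear)
  obtain d where d: "d > 0" "\<And>y. norm (y - a) < d \<Longrightarrow> norm (f y - f a - f' (y - a)) \<le> 1 * norm (y - a)"
    using f' unfolding has_derivative_at_alt by (meson zero_less_one)
  have "vanishes_to_order a 1 (\<lambda>x. f x - f a - f' (x - a))"
    by (rule vanishes_to_orderI[of _ 1], unfold eventually_nhds_metric)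
       (use d in \<open>auto simp: dist_norm intro!: exI[of _ d]\<close>)
  from vanishes_to_order_add[OF this vanishes_to_order_linear[OF bl, of a]]
  show ?thesis by simp
qed

text \<open>Differentiability of all directional derivatives at the single point \<open>a\<close> gives
  \<open>onorm (g' x - g' a) = O(norm (x - a))\<close> through the finitely many basis directions.  The mean value
  inequality for \<open>g - g' a\<close> on the segment from \<open>a\<close> to \<open>x\<close> then gains one more order.\<close>
lemma vanishes_to_order_2_taylor:
  fixes g :: "'a::euclidean_space \<Rightarrow> 'b::real_normed_vector"
  assumes "open D" "a \<in> D" "\<And>x. x \<in> D \<Longrightarrow> g differentiable (at x)"
    and d2: "\<And>v. (\<lambda>x. frechet_derivative g (at x) v) differentiable (at a)"
  shows "vanishes_to_order a 2 (\<lambda>x. g x - g a - frechet_derivative g (at a) (x - a))"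
proof -
  let ?g = "\<lambda>x. frechet_derivative g (at x)"
  have der: "(g has_derivative ?g x) (at x)" if "x \<in> D" for x
    using assms(3)[OF that] by (simp add: frechet_derivative_works)
  have lin: "bounded_linear (?g x)" if "x \<in> D" for x
    using der[OF that] by (rule has_derivative_bounded_linear)
  have "\<exists>C. 0 \<le> C \<and> (\<forall>\<^sub>F x in nhds a. norm (?g x b - ?g a b) \<le> C * norm (x - a))" for b
    by (rule vanishes_to_orderE[OF vanishes_to_order_differentiable[OF d2[of b]]]) auto
  have "\<exists>C. \<forall>b. 0 \<le> C b \<and> (\<forall>\<^sub>F x in nhds a. norm (?g x b - ?g a b) \<le> C b * norm (x - a))"
    by (rule choice, rule allI, fact)
  then obtain C where C': "\<forall>b. 0 \<le> C b \<and> (\<forall>\<^sub>F x in nhds a. norm (?g x b - ?g a b) \<le> C b * norm (x - a))" ..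
  then have C: "C b \<ge> 0"
    "\<forall>\<^sub>F x in nhds a. norm (?g x b - ?g a b) \<le> C b * norm (x - a)" for b
    by simp_all
  have "\<forall>\<^sub>F x in nhds a. x \<in> D \<and> (\<forall>b\<in>Basis. norm (?g x b - ?g a b) \<le> C b * norm (x - a))"
    using C(2) eventually_nhds_in_open[OF assms(1,2)]
    by (auto intro!: eventually_conj eventually_ball_finite)
  then obtain r where r: "r > 0" "\<And>x. dist x a < r \<Longrightarrow>
      x \<in> D \<and> (\<forall>b\<in>Basis. norm (?g x b - ?g a b) \<le> C b * norm (x - a))"
    unfolding eventually_nhds_metric by blast
  define M where "M = (\<Sum>b\<in>Basis. C b)"
  have on: "onorm (?g x - ?g a) \<le> M * norm (x - a)" if "dist x a < r" for x
  proof (rule onorm_le)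
    fix u :: 'a
    have x: "x \<in> D" using r(2) that by blast
    have L: "linear (?g x - ?g a)"
      using bounded_linear.linear[OF bounded_linear_sub[OF lin[OF x] lin[OF assms(2)]]]
      by (simp add: fun_diff_def)
    have "(?g x - ?g a) u = (?g x - ?g a) (\<Sum>b\<in>Basis. (u \<bullet> b) *\<^sub>R b)"
      by (simp add: euclidean_representation)
    also have "\<dots> = (\<Sum>b\<in>Basis. (u \<bullet> b) *\<^sub>R (?g x - ?g a) b)"
      by (simp only: linear_sum[OF L] linear_scale[OF L])
    also have "norm \<dots> \<le> (\<Sum>b\<in>Basis. norm u * (C b * norm (x - a)))"
    proof (rule sum_norm_le)
      fix b :: 'a assume b: "b \<in> Basis"
      then show "norm ((u \<bullet> b) *\<^sub>R (?g x - ?g a) b) \<le> norm u * (C b * norm (x - a))"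
        using r(2)[OF that] Basis_le_norm[OF b, of u] by (auto intro!: mult_mono)
    qed
    finally show "norm ((?g x - ?g a) u) \<le> M * norm (x - a) * norm u"
      by (simp add: M_def sum_distrib_left sum_distrib_right mult_ac)
  qed
  have M: "M \<ge> 0" using C(1) by (auto simp: M_def intro: sum_nonneg)
  have "norm (g y - g a - ?g a (y - a)) \<le> M * norm (y - a) ^ 2" if y: "dist y a < r" for y
  proof -
    let ?S = "closed_segment a y"
    have seg: "dist x a \<le> dist y a" if "x \<in> ?S" for x
      using segment_bound(1)[OF that] by (simp add: dist_norm norm_minus_commute)
    have "norm (g y - g a - ?g a (y - a)) \<le> norm (y - a) * (M * norm (y - a))"
    proof (rule differentiable_bound_linearization[where S = ?S])
      fix t :: real assume "t \<in> {0..1}"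
      then show "a + t *\<^sub>R (y - a) \<in> ?S" unfolding closed_segment_def
        by (auto simp: algebra_simps intro!: exI[of _ t])
    next
      fix x assume "x \<in> ?S"
      then show "(g has_derivative ?g x) (at x within ?S)"
        using der r(2)[of x] seg[of x] y by (auto intro: has_derivative_at_withinI)
    next
      fix x assume x: "x \<in> ?S"
      have "onorm (?g x - ?g a) \<le> M * norm (x - a)" using on seg[OF x] y by simp
      also have "\<dots> \<le> M * norm (y - a)" using seg[OF x] M by (intro mult_left_mono) (auto simp: dist_norm)
      finally show "onorm (?g x - ?g a) \<le> M * norm (y - a)" .
    qed simp
    then show ?thesis by (simp add: power2_eq_square mult_ac)
  qed
  then show ?thesis
    by (intro vanishes_to_orderI[of _ M]) (use r(1) in \<open>auto simp: eventually_nhds_metric\<close>)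
qed

lemma bounded_bilinear_matrix_mult:
  "bounded_bilinear ((**) :: real^'m^'n \<Rightarrow> real^'k^'m \<Rightarrow> real^'k^'n)"
  unfolding bilinear_conv_bounded_bilinear[symmetric] bilinear_def
  by (auto intro!: linearI simp: vec_eq_iff matrix_matrix_mult_def sum.distrib
      distrib_left distrib_right sum_distrib_left mult_ac)

lemma bounded_bilinear_matrix_vector_mult:
  "bounded_bilinear ((*v) :: real^'m^'n \<Rightarrow> real^'m \<Rightarrow> real^'n)"
  unfolding bilinear_conv_bounded_bilinear[symmetric] bilinear_def
  by (auto intro!: linearI simp: vec_eq_iff matrix_vector_mult_def sum.distrib
      distrib_left distrib_right sum_distrib_left mult_ac)

lemmas matrix_mult_distribs =
  bounded_bilinear.diff_left[OF bounded_bilinear_matrix_mult]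
  bounded_bilinear.diff_right[OF bounded_bilinear_matrix_mult]
  bounded_bilinear.add_left[OF bounded_bilinear_matrix_mult]
  bounded_bilinear.add_right[OF bounded_bilinear_matrix_mult]

lemmas has_leading_form_mult = has_leading_form_bounded_bilinear[OF bounded_bilinear_matrix_mult]
lemmas has_leading_form_mult_vec = has_leading_form_bounded_bilinear[OF bounded_bilinear_matrix_vector_mult]

lemma matrix_inv_cancel:
  assumes "invertible A"
  shows "A ** matrix_inv A = mat 1" "matrix_inv A ** A = mat 1"
  using someI_ex[of "\<lambda>A'. A ** A' = mat 1 \<and> A' ** A = mat 1"] assms
  unfolding invertible_def matrix_inv_def by auto

lemma eventually_invertible:
  fixes A :: "'a \<Rightarrow> real^'n^'n"
  assumes "(A \<longlongrightarrow> T) G" "invertible T"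
  shows "\<forall>\<^sub>F x in G. invertible (A x)"
proof -
  have "((\<lambda>x. det (A x)) \<longlongrightarrow> det T) G"
    unfolding det_def by (intro tendsto_intros assms)
  then have "\<forall>\<^sub>F x in G. det (A x) \<noteq> 0"
    using assms(2) by (intro tendsto_imp_eventually_ne) (auto simp: invertible_det_nz)
  then show ?thesis by (simp add: invertible_det_nz)
qed

text \<open>From \<open>X - S = - S (A - T) X\<close> with \<open>X\<close> and \<open>S\<close> the inverses of \<open>A\<close> and \<open>T\<close>: once \<open>A\<close> is close to \<open>T\<close>,
  this identity first bounds \<open>X\<close> by twice the norm of \<open>S\<close>, and then shows that the difference has the
  order of \<open>A - T\<close>.\<close>
lemma vanishes_to_order_matrix_inv:
  fixes A :: "'a::real_normed_vector \<Rightarrow> real^'n^'n"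
  assumes T: "invertible T" and A: "vanishes_to_order a 1 (\<lambda>x. A x - T)"
  shows "vanishes_to_order a 1 (\<lambda>x. matrix_inv (A x) - matrix_inv T)"
proof -
  obtain B where B: "\<And>(X::real^'n^'n) (Y::real^'n^'n). norm (X ** Y) \<le> norm X * norm Y * B" "0 \<le> B"
    using bounded_bilinear.nonneg_bounded[OF bounded_bilinear_matrix_mult] by blast
  let ?N = "norm (matrix_inv T)"
  have lim: "(A \<longlongrightarrow> T) (nhds a)" by (rule tendsto_nhds_if_vanishes_to_order[OF A]) simp
  have inv: "\<forall>\<^sub>F x in nhds a. invertible (A x)" by (rule eventually_invertible[OF lim T])
  have "((\<lambda>x. norm (A x - T) * (?N * B * B)) \<longlongrightarrow> norm (T - T) * (?N * B * B)) (nhds a)"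
    by (intro tendsto_intros lim)
  then have small: "\<forall>\<^sub>F x in nhds a. norm (A x - T) * (?N * B * B) < 1/2"
    by (intro order_tendstoD(2)[of _ "0::real"]) auto
  obtain C where C: "0 \<le> C" "\<forall>\<^sub>F x in nhds a. norm (A x - T) \<le> C * norm (x - a) ^ 1"
    using A vanishes_to_orderE by blast
  have "\<forall>\<^sub>F x in nhds a. norm (matrix_inv (A x) - matrix_inv T) \<le> (2 * ?N * ?N * B * B * C) * norm (x - a) ^ 1"
    using inv small C(2)
  proof eventually_elim
    case (elim x)
    let ?X = "matrix_inv (A x)"
    have 1: "?X - matrix_inv T = - (matrix_inv T ** ((A x - T) ** ?X))"
    proof -
      have "matrix_inv T ** ((A x - T) ** ?X) = matrix_inv T ** (A x ** ?X) - (matrix_inv T ** T) ** ?X"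
        by (simp add: bounded_bilinear.diff_left[OF bounded_bilinear_matrix_mult]
            bounded_bilinear.diff_right[OF bounded_bilinear_matrix_mult] matrix_mul_assoc)
      then show ?thesis by (simp add: matrix_inv_cancel[OF T] matrix_inv_cancel[OF elim(1)])
    qed
    have "norm (?X - matrix_inv T) \<le> ?N * norm ((A x - T) ** ?X) * B"
      unfolding 1 norm_minus_cancel by (rule B)
    also have "\<dots> \<le> ?N * (norm (A x - T) * norm ?X * B) * B"
      by (intro mult_right_mono mult_left_mono B norm_ge_zero)
    finally have 2: "norm (?X - matrix_inv T) \<le> norm (A x - T) * (?N * B * B) * norm ?X"
      by (simp add: mult_ac)
    also have "\<dots> \<le> 1/2 * norm ?X" using elim(2) by (intro mult_right_mono) auto
    finally have X: "norm ?X \<le> 2 * ?N"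
      using norm_triangle_sub[of ?X "matrix_inv T"] by simp
    have "norm (A x - T) * (?N * B * B) * norm ?X \<le> (C * norm (x - a) ^ 1) * (?N * B * B) * (2 * ?N)"
      using X elim(3) B(2) C(1) by (intro mult_mono mult_right_mono) auto
    with 2 show ?case by (simp add: mult_ac)
  qed
  then show ?thesis by (rule vanishes_to_orderI)
qed

section \<open>Divided differences near a regular zero\<close>

lemma C_times_on_Suc_imp: "C_times_on (Suc r) S f \<Longrightarrow> C_times_on r S f"
proof (induction r arbitrary: f)
  case 0
  then show ?case
    by (auto intro: differentiable_imp_continuous_within differentiable_at_withinI
        simp: continuous_on_eq_continuous_within)
qed auto

lemma C_times_on_le:
  assumes "C_times_on s S f" "r \<le> s"
  shows "C_times_on r S f"
  using assms(2,1) by (induction s rule: dec_induct) (auto dest: C_times_on_Suc_imp simp del: C_times_on.simps)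

text \<open>Three derivatives are what makes the jacobian, and with it the divided difference, agree with its
  linearization up to an error of second order.\<close>
locale regular_zero =
  fixes F :: "real^'n \<Rightarrow> real^'n" and D :: "(real^'n) set" and \<alpha> :: "real^'n"
  assumes open_D: "open D" and \<alpha>_in_D: "\<alpha> \<in> D" and smooth: "C_times_on 3 D F"
    and zero: "F \<alpha> = 0" and regular: "invertible (jacobian F (at \<alpha>))"
begin

abbreviation "T \<equiv> jacobian F (at \<alpha>)"

lemma F_differentiable: "x \<in> D \<Longrightarrow> F differentiable (at x)"
  using smooth by (simp add: numeral_3_eq_3)

text \<open>Smoothness is given for the directional derivatives of \<open>F\<close>; writing the jacobian as a sum of its
  columns transfers it to the matrix.\<close>
lemma jacobian_columns:
  "jacobian F (at x) =
     (\<Sum>j\<in>UNIV. (\<chi> i k. if k = j then frechet_derivative F (at x) (axis j 1) $ i else 0))"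
  by (simp add: jacobian_def matrix_def vec_eq_iff)

lemma bounded_linear_column:
  "bounded_linear (\<lambda>c::real^'n. (\<chi> i k. if k = j then c $ i else 0) :: real^'n^'n)"
  by (rule linear_conv_bounded_linear[THEN iffD1], rule linearI) (auto simp: vec_eq_iff)

lemma column_differentiable:
  "x \<in> D \<Longrightarrow> (\<lambda>x. frechet_derivative F (at x) v) differentiable (at x)"
  using smooth by (simp add: numeral_3_eq_3)

lemma continuous_on_jacobian: "continuous_on D (\<lambda>x. jacobian F (at x))"
  unfolding jacobian_columns
  by (intro continuous_on_sum bounded_linear.continuous_on[OF bounded_linear_column]
      differentiable_imp_continuous_on)
     (auto simp: differentiable_on_def intro: differentiable_at_withinI column_differentiable)

lemma jacobian_taylor:
  obtains B where "bounded_linear B"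
    "vanishes_to_order \<alpha> 2 (\<lambda>x. jacobian F (at x) - T - B (x - \<alpha>))"
proof -
  let ?P = "\<lambda>j (c::real^'n). (\<chi> i k. if k = j then c $ i else 0) :: real^'n^'n"
  let ?G = "\<lambda>j x. frechet_derivative F (at x) (axis j 1)"
  let ?L = "\<lambda>j. frechet_derivative (?G j) (at \<alpha>)"
  define B where "B u = (\<Sum>j\<in>UNIV. ?P j (?L j u))" for u
  have L: "bounded_linear (?L j)" for j
    using column_differentiable[OF \<alpha>_in_D]
    by (meson frechet_derivative_works has_derivative_bounded_linear)
  show thesis
  proof (rule that[of B])
    show "bounded_linear B" unfolding B_def
      by (intro bounded_linear_sum bounded_linear_compose[OF bounded_linear_column L])
    have "vanishes_to_order \<alpha> 2 (\<lambda>x. ?G j x - ?G j \<alpha> - ?L j (x - \<alpha>))" for j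
      using smooth \<alpha>_in_D
      by (intro vanishes_to_order_2_taylor[OF open_D \<alpha>_in_D])
         (auto simp: numeral_3_eq_3)
    then have "vanishes_to_order \<alpha> 2 (\<lambda>x. \<Sum>j\<in>UNIV. ?P j (?G j x - ?G j \<alpha> - ?L j (x - \<alpha>)))"
      by (intro vanishes_to_order_sum vanishes_to_order_bounded_linear[OF bounded_linear_column])
    moreover have "(\<Sum>j\<in>UNIV. ?P j (?G j x - ?G j \<alpha> - ?L j (x - \<alpha>)))
        = jacobian F (at x) - T - B (x - \<alpha>)" for x
      unfolding jacobian_columns B_def
      by (simp add: sum_subtractf linear_diff[OF bounded_linear.linear[OF bounded_linear_column]])
    ultimately show "vanishes_to_order \<alpha> 2 (\<lambda>x. jacobian F (at x) - T - B (x - \<alpha>))"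
      by simp
  qed
qed

lemma jacobian_segment_integrable:
  assumes "closed_segment z y \<subseteq> D"
  shows "(\<lambda>t. jacobian F (at (z + t *\<^sub>R (y - z)))) integrable_on {0..1}"
proof (rule integrable_continuous_interval, rule continuous_on_compose2[OF continuous_on_jacobian])
  show "(\<lambda>t. z + t *\<^sub>R (y - z)) ` {0..1} \<subseteq> D"
    using assms by (auto simp: closed_segment_image_interval algebra_simps image_subset_iff)
qed (intro continuous_intros)

text \<open>The fundamental theorem of calculus for \<open>F\<close> along the segment from \<open>z\<close> to \<open>y\<close>.\<close>
lemma divided_difference_mult:
  assumes "closed_segment z y \<subseteq> D"
  shows "divided_difference y z F *v (y - z) = F y - F z"
proof -
  let ?p = "\<lambda>t::real. z + t *\<^sub>R (y - z)"
  have p: "?p t \<in> D" if "t \<in> {0..1}" for t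
    using assms that by (auto simp: closed_segment_image_interval algebra_simps image_subset_iff)
  have "((\<lambda>t. F (?p t)) has_vector_derivative jacobian F (at (?p t)) *v (y - z)) (at t within {0..1})"
    if "t \<in> {0..1}" for t
  proof -
    have F: "(F has_derivative (*v) (jacobian F (at (?p t)))) (at (?p t))"
      using F_differentiable[OF p[OF that]] jacobian_works by blast
    have "(?p has_vector_derivative (y - z)) (at t within {0..1})"
      by (auto intro!: derivative_eq_intros simp: has_vector_derivative_def)
    from has_derivative_compose[OF this[unfolded has_vector_derivative_def] F]
    show ?thesis unfolding has_vector_derivative_def
      by (simp add: matrix_vector_mult_scaleR)
  qed
  then have ftc: "((\<lambda>t. jacobian F (at (?p t)) *v (y - z)) has_integral F (?p 1) - F (?p 0)) {0..1}"
    by (intro fundamental_theorem_of_calculus) auto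
  have "((\<lambda>t. jacobian F (at (?p t))) has_integral divided_difference y z F) {0..1}"
    unfolding divided_difference_def
    by (rule integrable_integral[OF jacobian_segment_integrable[OF assms]])
  from has_integral_linear[OF this bounded_bilinear.bounded_linear_left[OF bounded_bilinear_matrix_vector_mult]]
  have "((\<lambda>t. jacobian F (at (?p t)) *v (y - z)) has_integral divided_difference y z F *v (y - z)) {0..1}"
    by (simp add: o_def)
  from has_integral_unique[OF this ftc] show ?thesis by simp
qed

text \<open>Integrating the linearization of the jacobian along the segment replaces the point by the midpoint of
  \<open>y\<close> and \<open>z\<close>.  The remainder is uniform in both endpoints, so it is expressed as vanishing at the point
  \<open>(\<alpha>, \<alpha>)\<close> of the product space; this makes it composable with any pair of points that depend on \<open>x\<close>.\<close>
lemma divided_difference_taylor: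
  obtains B where "bounded_linear B"
    "vanishes_to_order (\<alpha>, \<alpha>) 2
       (\<lambda>(y, z). divided_difference y z F - T - (1/2) *\<^sub>R B ((y - \<alpha>) + (z - \<alpha>)))"
proof -
  obtain B where B: "bounded_linear B"
    "vanishes_to_order \<alpha> 2 (\<lambda>x. jacobian F (at x) - T - B (x - \<alpha>))"
    by (rule jacobian_taylor)
  obtain C where C: "0 \<le> C" "\<forall>\<^sub>F x in nhds \<alpha>. norm (jacobian F (at x) - T - B (x - \<alpha>)) \<le> C * norm (x - \<alpha>) ^ 2"
    using B(2) vanishes_to_orderE by blast
  have "\<forall>\<^sub>F x in nhds \<alpha>. x \<in> D \<and> norm (jacobian F (at x) - T - B (x - \<alpha>)) \<le> C * norm (x - \<alpha>) ^ 2"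
    using C(2) eventually_nhds_in_open[OF open_D \<alpha>_in_D] by eventually_elim simp
  then obtain r where r: "r > 0" "\<And>x. dist x \<alpha> < r \<Longrightarrow>
      x \<in> D \<and> norm (jacobian F (at x) - T - B (x - \<alpha>)) \<le> C * norm (x - \<alpha>) ^ 2"
    unfolding eventually_nhds_metric by blast
  have "norm (divided_difference y z F - T - (1/2) *\<^sub>R B ((y - \<alpha>) + (z - \<alpha>)))
      \<le> C * norm ((y, z) - (\<alpha>, \<alpha>)) ^ 2" if near: "dist (y, z) (\<alpha>, \<alpha>) < r" for y z
  proof -
    define N where "N = norm ((y, z) - (\<alpha>, \<alpha>))"
    have N: "N < r" using near by (simp add: N_def dist_norm)
    have yz: "norm (y - \<alpha>) \<le> N" "norm (z - \<alpha>) \<le> N"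
      using norm_fst_le[of "y - \<alpha>" "z - \<alpha>"] norm_snd_le[of "z - \<alpha>" "y - \<alpha>"] by (simp_all add: N_def)
    let ?p = "\<lambda>t::real. z + t *\<^sub>R (y - z)"
    have p: "norm (?p t - \<alpha>) \<le> N" if t: "t \<in> {0..1}" for t
    proof -
      have "?p t - \<alpha> = (1 - t) *\<^sub>R (z - \<alpha>) + t *\<^sub>R (y - \<alpha>)" by (simp add: algebra_simps)
      also have "norm \<dots> \<le> (1 - t) * norm (z - \<alpha>) + t * norm (y - \<alpha>)"
        using t by (intro norm_triangle_le) simp
      also have "\<dots> \<le> (1 - t) * N + t * N"
        using t yz by (intro add_mono mult_left_mono) auto
      finally show ?thesis by (simp add: algebra_simps)
    qed
    have "closed_segment z y \<subseteq> D"
    proof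
      fix x assume "x \<in> closed_segment z y"
      then obtain t where t: "t \<in> {0..1}" "x = (1 - t) *\<^sub>R z + t *\<^sub>R y"
        by (auto simp: in_segment)
      then have "x = ?p t" by (simp add: algebra_simps)
      then show "x \<in> D" using p[OF t(1)] N r(2)[of x] by (simp add: dist_norm)
    qed
    then have I1: "((\<lambda>t. jacobian F (at (?p t))) has_integral divided_difference y z F) {0..1}"
      unfolding divided_difference_def
      by (intro integrable_integral jacobian_segment_integrable)
    \<comment> \<open>The integrand is affine in \<open>t\<close>, so a primitive can be written down.\<close>
    have I0: "((\<lambda>t. T + B (?p t - \<alpha>)) has_integral
        (1 *\<^sub>R (T + B (z - \<alpha>)) + (1\<^sup>2 / 2) *\<^sub>R B (y - z)) -
        (0 *\<^sub>R (T + B (z - \<alpha>)) + (0\<^sup>2 / 2) *\<^sub>R B (y - z))) {0..1}"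
    proof (rule fundamental_theorem_of_calculus)
      fix t :: real
      have "B (?p t - \<alpha>) = B (z - \<alpha>) + t *\<^sub>R B (y - z)"
        using linear_add[OF bounded_linear.linear[OF B(1)], of "z - \<alpha>" "t *\<^sub>R (y - z)"]
          linear_scale[OF bounded_linear.linear[OF B(1)], of t "y - z"] by (simp add: algebra_simps)
      then show "((\<lambda>t. t *\<^sub>R (T + B (z - \<alpha>)) + (t\<^sup>2 / 2) *\<^sub>R B (y - z))
          has_vector_derivative (T + B (?p t - \<alpha>))) (at t within {0..1})"
        by (auto intro!: derivative_eq_intros simp: has_vector_derivative_def algebra_simps)
    qed simp
    have I2: "((\<lambda>t. T + B (?p t - \<alpha>)) has_integral
        T + (1/2) *\<^sub>R B ((y - \<alpha>) + (z - \<alpha>))) {0..1}"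
    proof -
      have "B (z - \<alpha>) + (1/2) *\<^sub>R B (y - z) = B ((z - \<alpha>) + (1/2) *\<^sub>R (y - z))"
        by (simp add: linear_add[OF bounded_linear.linear[OF B(1)]] linear_scale[OF bounded_linear.linear[OF B(1)]])
      also have "(z - \<alpha>) + (1/2) *\<^sub>R (y - z) = (1/2) *\<^sub>R ((y - \<alpha>) + (z - \<alpha>))"
        by (simp add: vec_eq_iff field_simps)
      finally have "B (z - \<alpha>) + (1/2) *\<^sub>R B (y - z) = (1/2) *\<^sub>R B ((y - \<alpha>) + (z - \<alpha>))"
        by (simp only: linear_scale[OF bounded_linear.linear[OF B(1)]])
      then show ?thesis using I0 by (simp add: add.assoc)
    qed
    from has_integral_diff[OF I1 I2]
    have "norm (divided_difference y z F - (T + (1/2) *\<^sub>R B ((y - \<alpha>) + (z - \<alpha>))))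
        \<le> (C * N ^ 2) * measure lborel (cbox 0 (1::real))"
    proof (intro has_integral_bound)
      fix t :: real assume "t \<in> cbox 0 1"
      then have t: "t \<in> {0..1}" by simp
      have "norm (jacobian F (at (?p t)) - T - B (?p t - \<alpha>)) \<le> C * norm (?p t - \<alpha>) ^ 2"
        using r(2)[of "?p t"] p[OF t] N by (simp add: dist_norm)
      also have "\<dots> \<le> C * N ^ 2"
        using p[OF t] C(1) by (intro mult_left_mono power_mono) auto
      finally show "norm (jacobian F (at (?p t)) - (T + B (?p t - \<alpha>))) \<le> C * N ^ 2"
        by (simp add: diff_diff_eq)
    qed (use C(1) in auto)
    then show ?thesis by (simp add: N_def diff_diff_eq)
  qed
  then have "vanishes_to_order (\<alpha>, \<alpha>) 2
       (\<lambda>(y, z). divided_difference y z F - T - (1/2) *\<^sub>R B ((y - \<alpha>) + (z - \<alpha>)))"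
    using r(1) by (intro vanishes_to_orderI[of _ C]) (auto simp: eventually_nhds_metric simp del: norm_Pair diff_Pair)
  then show thesis using that B(1) by blast
qed

text \<open>The midpoint term inherits degree \<open>p\<close> from \<open>y\<close> and \<open>z\<close>, and the remainder has order \<open>2 * p > p\<close>.\<close>
lemma has_leading_form_divided_difference_diff:
  fixes y z :: "real^'n \<Rightarrow> real^'n"
  assumes p: "1 \<le> p" and y: "has_leading_form \<alpha> p (\<lambda>x. y x - \<alpha>)" and z: "has_leading_form \<alpha> p (\<lambda>x. z x - \<alpha>)"
  shows "has_leading_form \<alpha> p (\<lambda>x. divided_difference (y x) (z x) F - T)"
proof -
  obtain B where B: "bounded_linear B"
    "vanishes_to_order (\<alpha>, \<alpha>) 2
       (\<lambda>(y, z). divided_difference y z F - T - (1/2) *\<^sub>R B ((y - \<alpha>) + (z - \<alpha>)))"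
    by (rule divided_difference_taylor)
  have "vanishes_to_order \<alpha> p (\<lambda>x. (y x, z x) - (\<alpha>, \<alpha>))"
    using y z vanishes_to_order_Pair[of \<alpha> p "\<lambda>x. y x - \<alpha>" "\<lambda>x. z x - \<alpha>"]
    by (simp add: has_leading_form_def)
  from vanishes_to_order_compose[OF B(2) this p]
  have "vanishes_to_order \<alpha> (p * 2) (\<lambda>x. divided_difference (y x) (z x) F - T - (1/2) *\<^sub>R B ((y x - \<alpha>) + (z x - \<alpha>)))"
    by simp
  then have rem: "has_leading_form \<alpha> p (\<lambda>x. divided_difference (y x) (z x) F - T - (1/2) *\<^sub>R B ((y x - \<alpha>) + (z x - \<alpha>)))"
    by (rule has_leading_form_if_vanishes) (use p in simp)
  have "has_leading_form \<alpha> p (\<lambda>x. (1/2) *\<^sub>R B ((y x - \<alpha>) + (z x - \<alpha>)))"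
    by (intro has_leading_form_bounded_linear[OF bounded_linear_scaleR_right]
        has_leading_form_bounded_linear[OF B(1)] has_leading_form_add y z)
  from has_leading_form_add[OF rem this] show ?thesis by simp
qed

lemma eventually_closed_segment_subset:
  assumes "(y \<longlongrightarrow> \<alpha>) G" "(z \<longlongrightarrow> \<alpha>) G"
  shows "\<forall>\<^sub>F x in G. closed_segment (y x) (z x) \<subseteq> D"
proof -
  obtain r where r: "r > 0" "ball \<alpha> r \<subseteq> D"
    using open_D \<alpha>_in_D open_contains_ball by blast
  have "\<forall>\<^sub>F x in G. y x \<in> ball \<alpha> r" "\<forall>\<^sub>F x in G. z x \<in> ball \<alpha> r"
    by (rule topological_tendstoD[OF assms(1)] topological_tendstoD[OF assms(2)]; use r(1) in simp)+
  then show ?thesis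
  proof eventually_elim
    case (elim x)
    then show ?case using closed_segment_subset[OF _ _ convex_ball] r(2) by blast
  qed
qed

lemma eventually_F_eq:
  assumes "(z \<longlongrightarrow> \<alpha>) G"
  shows "\<forall>\<^sub>F x in G. F (z x) = divided_difference (z x) \<alpha> F *v (z x - \<alpha>)"
  using eventually_closed_segment_subset[OF tendsto_const assms]
  by eventually_elim (simp add: divided_difference_mult zero)

lemma has_leading_form_F:
  assumes p: "1 \<le> p" and z: "has_leading_form \<alpha> p (\<lambda>x. z x - \<alpha>)"
  shows "has_leading_form \<alpha> p (\<lambda>x. F (z x))"
proof -
  have "has_leading_form \<alpha> 0 (\<lambda>x. divided_difference (z x) \<alpha> F)"
    by (rule has_leading_form_shift[OF has_leading_form_divided_difference_diff[OF p z]])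
       (simp add: has_leading_form_zero)
  from has_leading_form_bounded_bilinear[OF bounded_bilinear_matrix_vector_mult this z]
  have "has_leading_form \<alpha> p (\<lambda>x. divided_difference (z x) \<alpha> F *v (z x - \<alpha>))" by simp
  moreover have "(z \<longlongrightarrow> \<alpha>) (nhds \<alpha>)"
    using z p tendsto_nhds_if_vanishes_to_order by (auto simp: has_leading_form_def)
  note eventually_F_eq[OF this]
  then have "\<forall>\<^sub>F x in nhds \<alpha>. divided_difference (z x) \<alpha> F *v (z x - \<alpha>) = F (z x)"
    by eventually_elim simp
  ultimately show ?thesis by (rule has_leading_form_cong)
qed

end

section \<open>The error of one step of the method\<close>

text \<open>The expansion in \<open>weight_function\<close> is over the punctured neighbourhood; at \<open>mat 1\<close> itself its
  remainder is zero.\<close>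
lemma weight_function_expansion:
  assumes "weight_function H H1 H2"
  shows "vanishes_to_order (mat 1) 3
    (\<lambda>t. H t - (H (mat 1) + H1 *\<^sub>R (t - mat 1) + (H2 / 2) *\<^sub>R ((t - mat 1) ** (t - mat 1))))"
    (is "vanishes_to_order _ _ ?R")
proof -
  have "(\<lambda>t. norm (?R t)) \<in> O[at (mat 1)](\<lambda>t. norm (t - mat 1) ^ 3)"
    using assms unfolding weight_function_def by blast
  then obtain c where c: "\<forall>\<^sub>F t in at (mat 1). norm (norm (?R t)) \<le> c * norm (norm (t - mat 1) ^ 3)"
    by (elim landau_o.bigE)
  have "(0::real^'a^'a) ** 0 = 0"
    by (rule bounded_bilinear.zero_left[OF bounded_bilinear_matrix_mult])
  then have "?R (mat 1) = 0" by simp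
  with c have "\<forall>\<^sub>F t in nhds (mat 1). norm (?R t) \<le> c * norm (t - mat 1) ^ 3"
    unfolding eventually_at_filter by (auto elim!: eventually_mono)
  then show ?thesis by (rule vanishes_to_orderI)
qed

context regular_zero
begin

lemma has_leading_form_SW_w: "has_leading_form \<alpha> 1 (\<lambda>x. SW_w F \<beta> x - \<alpha>)"
proof -
  have "has_leading_form \<alpha> 1 (\<lambda>x. (x - \<alpha>) + \<beta> *\<^sub>R F x)"
    by (intro has_leading_form_add has_leading_form_id
        has_leading_form_bounded_linear[OF bounded_linear_scaleR_right]
        has_leading_form_F[of 1 "\<lambda>x. x"]) simp
  then show ?thesis by (simp add: SW_w_def algebra_simps)
qed

lemma has_leading_form_SW_A: "has_leading_form \<alpha> 1 (\<lambda>x. SW_A F \<beta> x - T)"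
  unfolding SW_A_def
  by (intro has_leading_form_divided_difference_diff has_leading_form_SW_w has_leading_form_id) simp

lemma eventually_invertible_SW_A: "\<forall>\<^sub>F x in nhds \<alpha>. invertible (SW_A F \<beta> x)"
  by (rule eventually_invertible[OF has_leading_form_tendsto[OF has_leading_form_SW_A] regular]) simp

lemma has_leading_form_inv_SW_A: "has_leading_form \<alpha> 0 (\<lambda>x. matrix_inv (SW_A F \<beta> x))"
  by (rule has_leading_form_shift[of _ 0], rule has_leading_form_if_vanishes,
      rule vanishes_to_order_matrix_inv[OF regular])
     (use has_leading_form_SW_A in \<open>auto simp: has_leading_form_def\<close>)

text \<open>With \<open>A\<close> the matrix of the step, \<open>X\<close> its inverse and \<open>d\<close> the divided difference of \<open>x\<close> and \<open>\<alpha>\<close>, the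
  error is \<open>X (A - d) (x - \<alpha>)\<close>.  Both \<open>A\<close> and \<open>d\<close> are \<open>T\<close> plus a term of degree 1, so \<open>A - d\<close> contributes
  one degree and \<open>x - \<alpha>\<close> the other.\<close>
lemma has_leading_form_SW_z1: "has_leading_form \<alpha> 2 (\<lambda>x. SW_z1 F \<beta> x - \<alpha>)"
proof -
  let ?A = "SW_A F \<beta>" and ?d = "\<lambda>x. divided_difference x \<alpha> F"
  have "has_leading_form \<alpha> 1 (\<lambda>x. ?d x - T)"
    by (intro has_leading_form_divided_difference_diff has_leading_form_id)
       (simp_all add: has_leading_form_zero)
  from has_leading_form_mult_vec[OF has_leading_form_mult[OF has_leading_form_inv_SW_A
        has_leading_form_diff[OF has_leading_form_SW_A this]] has_leading_form_id]
  have form: "has_leading_form \<alpha> 2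
      (\<lambda>x. (matrix_inv (?A x) ** ((?A x - T) - (?d x - T))) *v (x - \<alpha>))"
    by (simp add: numeral_2_eq_2)
  have lim: "((\<lambda>x. x) \<longlongrightarrow> \<alpha>) (nhds \<alpha>)" by (simp add: filterlim_ident)
  have "\<forall>\<^sub>F x in nhds \<alpha>.
      (matrix_inv (?A x) ** ((?A x - T) - (?d x - T))) *v (x - \<alpha>) = SW_z1 F \<beta> x - \<alpha>"
    using eventually_invertible_SW_A[of \<beta>] eventually_F_eq[OF lim]
  proof eventually_elim
    case (elim x)
    have "(matrix_inv (?A x) ** ((?A x - T) - (?d x - T))) *v (x - \<alpha>)
        = (mat 1 - matrix_inv (?A x) ** ?d x) *v (x - \<alpha>)"
      by (simp add: matrix_mult_distribs matrix_inv_cancel[OF elim(1)])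
    also have "\<dots> = (x - \<alpha>) - matrix_inv (?A x) *v F x"
      by (simp add: elim(2) matrix_vector_mult_diff_rdistrib matrix_vector_mul_assoc)
    finally show ?case by (simp add: SW_z1_def)
  qed
  with form show ?thesis by (rule has_leading_form_cong)
qed

lemma has_leading_form_SW_v: "has_leading_form \<alpha> 2 (\<lambda>x. SW_v F \<beta> \<delta> x - \<alpha>)"
proof -
  have "has_leading_form \<alpha> 2 (\<lambda>x. (SW_z1 F \<beta> x - \<alpha>) + \<delta> *\<^sub>R F (SW_z1 F \<beta> x))"
    by (intro has_leading_form_add has_leading_form_SW_z1
        has_leading_form_bounded_linear[OF bounded_linear_scaleR_right] has_leading_form_F) simp
  then show ?thesis by (simp add: SW_v_def algebra_simps)
qed

lemma has_leading_form_SW_divided_difference: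
  "has_leading_form \<alpha> 2 (\<lambda>x. divided_difference (SW_z1 F \<beta> x) (SW_v F \<beta> \<delta> x) F - T)"
  by (intro has_leading_form_divided_difference_diff has_leading_form_SW_z1 has_leading_form_SW_v) simp

lemma has_leading_form_SW_t: "has_leading_form \<alpha> 1 (\<lambda>x. SW_t F \<beta> \<delta> x - mat 1)"
proof -
  let ?A = "SW_A F \<beta>" and ?d = "\<lambda>x. divided_difference (SW_z1 F \<beta> x) (SW_v F \<beta> \<delta> x) F"
  have "has_leading_form \<alpha> 1 (\<lambda>x. ?d x - T)"
    by (rule has_leading_form_weaken[OF has_leading_form_SW_divided_difference]) simp
  from has_leading_form_mult[OF has_leading_form_inv_SW_A has_leading_form_diff[OF this has_leading_form_SW_A]]
  have form: "has_leading_form \<alpha> 1 (\<lambda>x. matrix_inv (?A x) ** ((?d x - T) - (?A x - T)))" by simp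
  have "\<forall>\<^sub>F x in nhds \<alpha>. matrix_inv (?A x) ** ((?d x - T) - (?A x - T)) = SW_t F \<beta> \<delta> x - mat 1"
    using eventually_invertible_SW_A[of \<beta>]
    by eventually_elim (simp add: matrix_mult_distribs matrix_inv_cancel SW_t_def)
  with form show ?thesis by (rule has_leading_form_cong)
qed

text \<open>The values \<open>H (mat 1) = mat 1\<close> and \<open>H1 = - 1\<close> make \<open>H\<close> agree with the inverse to first order: for
  \<open>t = mat 1 + u\<close> the expansion begins with \<open>mat 1 - u\<close>.\<close>
lemma has_leading_form_SW_H:
  assumes "weight_function H (- 1) H2" "H (mat 1) = mat 1"
  shows "has_leading_form \<alpha> 2 (\<lambda>x. H (SW_t F \<beta> \<delta> x) - mat 1 + (SW_t F \<beta> \<delta> x - mat 1))"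
proof -
  let ?u = "\<lambda>x. SW_t F \<beta> \<delta> x - mat 1"
  have "vanishes_to_order \<alpha> 1 ?u" using has_leading_form_SW_t by (auto simp: has_leading_form_def)
  from vanishes_to_order_compose[OF weight_function_expansion[OF assms(1)] this]
  have "has_leading_form \<alpha> 2 (\<lambda>x. H (SW_t F \<beta> \<delta> x)
      - (H (mat 1) + (- 1) *\<^sub>R ?u x + (H2 / 2) *\<^sub>R (?u x ** ?u x)))"
    by (intro has_leading_form_if_vanishes[where q = 3]) simp_all
  moreover have "has_leading_form \<alpha> 2 (\<lambda>x. (H2 / 2) *\<^sub>R (?u x ** ?u x))"
    using has_leading_form_mult[OF has_leading_form_SW_t has_leading_form_SW_t]
    by (intro has_leading_form_bounded_linear[OF bounded_linear_scaleR_right])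
       (simp add: numeral_2_eq_2)
  ultimately have "has_leading_form \<alpha> 2 (\<lambda>x. H (SW_t F \<beta> \<delta> x)
      - (H (mat 1) + (- 1) *\<^sub>R ?u x + (H2 / 2) *\<^sub>R (?u x ** ?u x)) + (H2 / 2) *\<^sub>R (?u x ** ?u x))"
    by (rule has_leading_form_add)
  then show ?thesis by (simp add: assms(2) algebra_simps)
qed

text \<open>The error is multiplied by \<open>M = mat 1 - H t ** X ** e\<close>, where \<open>X\<close> is the inverse of the matrix of the
  step and \<open>e\<close> is the divided difference of \<open>z\<close> and \<open>\<alpha>\<close>.  Since \<open>z\<close>, \<open>z1\<close> and \<open>v\<close> agree with \<open>\<alpha>\<close> up to order
  2, \<open>X ** e\<close> differs from \<open>t = mat 1 + u\<close> by a term \<open>r\<close> of degree 2.  With \<open>H t = mat 1 - u + h\<close> the linear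
  terms in \<open>u\<close> cancel, and every term that remains in \<open>M\<close> has degree at least 2.\<close>
lemma has_leading_form_SW_step:
  assumes H: "weight_function H (- 1) H2" "H (mat 1) = mat 1"
    and p: "2 \<le> p" and z: "has_leading_form \<alpha> p (\<lambda>x. z x - \<alpha>)"
  shows "has_leading_form \<alpha> (2 + p)
    (\<lambda>x. z x - (H (SW_t F \<beta> \<delta> x) ** matrix_inv (SW_A F \<beta> x)) *v F (z x) - \<alpha>)"
proof -
  let ?t = "SW_t F \<beta> \<delta>" and ?X = "\<lambda>x. matrix_inv (SW_A F \<beta> x)"
    and ?d = "\<lambda>x. divided_difference (SW_z1 F \<beta> x) (SW_v F \<beta> \<delta> x) F"
    and ?e = "\<lambda>x. divided_difference (z x) \<alpha> F"
  define u where "u x = ?t x - mat 1" for x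
  define h where "h x = H (?t x) - mat 1 + u x" for x
  define r where "r x = ?X x ** ((?e x - T) - (?d x - T))" for x
  \<comment> \<open>This is \<open>mat 1 - (mat 1 - u + h) ** (mat 1 + u + r)\<close> multiplied out.\<close>
  define M where "M x = u x ** u x - r x + u x ** r x - h x ** (mat 1 + u x + r x)" for x
  have u: "has_leading_form \<alpha> 1 u" unfolding u_def by (rule has_leading_form_SW_t)
  have h: "has_leading_form \<alpha> 2 h" unfolding h_def u_def by (rule has_leading_form_SW_H[OF H])
  have z2: "has_leading_form \<alpha> 2 (\<lambda>x. z x - \<alpha>)" by (rule has_leading_form_weaken[OF z p])
  have "has_leading_form \<alpha> 2 (\<lambda>x. ?e x - T)"
    by (intro has_leading_form_divided_difference_diff z2) (simp_all add: has_leading_form_zero)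
  from has_leading_form_mult[OF has_leading_form_inv_SW_A has_leading_form_diff[OF this has_leading_form_SW_divided_difference]]
  have r: "has_leading_form \<alpha> 2 r" unfolding r_def by (simp only: add_0_left)
  have uu: "has_leading_form \<alpha> 2 (\<lambda>x. u x ** u x)"
    using has_leading_form_mult[OF u u] by (simp add: numeral_2_eq_2)
  have ur: "has_leading_form \<alpha> 2 (\<lambda>x. u x ** r x)"
    by (rule has_leading_form_weaken[OF has_leading_form_mult[OF u r]]) simp
  have "has_leading_form \<alpha> 0 (\<lambda>x. mat 1 + u x + r x)"
    by (intro has_leading_form_add has_leading_form_const
        has_leading_form_weaken[OF u] has_leading_form_weaken[OF r]) simp_all
  from has_leading_form_mult[OF h this]
  have "has_leading_form \<alpha> 2 (\<lambda>x. h x ** (mat 1 + u x + r x))" by (simp only: add_0_right)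
  then have "has_leading_form \<alpha> 2 M" unfolding M_def
    by (intro has_leading_form_add has_leading_form_diff uu ur r)
  from has_leading_form_mult_vec[OF this z]
  have form: "has_leading_form \<alpha> (2 + p) (\<lambda>x. M x *v (z x - \<alpha>))" .
  have "(z \<longlongrightarrow> \<alpha>) (nhds \<alpha>)" using z p by (intro has_leading_form_tendsto[OF z]) simp
  from eventually_F_eq[OF this]
  have "\<forall>\<^sub>F x in nhds \<alpha>. M x *v (z x - \<alpha>) = z x - (H (?t x) ** ?X x) *v F (z x) - \<alpha>"
  proof eventually_elim
    case (elim x)
    have Hx: "H (?t x) = mat 1 - u x + h x" by (simp add: h_def)
    have e: "?X x ** ?e x = mat 1 + u x + r x"
      by (simp add: u_def r_def SW_t_def matrix_mult_distribs)
    have "H (?t x) ** (?X x ** ?e x) = mat 1 - M x"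
      unfolding Hx e M_def by (simp add: matrix_mult_distribs)
    then have "(H (?t x) ** ?X x) *v F (z x) = (mat 1 - M x) *v (z x - \<alpha>)"
      by (simp add: elim matrix_vector_mul_assoc matrix_mul_assoc)
    then show ?case by (simp add: matrix_vector_mult_diff_rdistrib)
  qed
  with form show ?thesis by (rule has_leading_form_cong)
qed

lemma has_leading_form_SW_z:
  assumes H: "weight_function H (- 1) H2" "H (mat 1) = mat 1" and j: "1 \<le> j"
  shows "has_leading_form \<alpha> (2 * j) (\<lambda>x. SW_z F H \<beta> \<delta> x j - \<alpha>)"
  using j
proof (induction j rule: dec_induct)
  case base
  then show ?case using has_leading_form_SW_z1 by (simp add: SW_z_def)
next
  case (step j)
  have "SW_z F H \<beta> \<delta> x (Suc j) = SW_z F H \<beta> \<delta> x j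
      - (H (SW_t F \<beta> \<delta> x) ** matrix_inv (SW_A F \<beta> x)) *v F (SW_z F H \<beta> \<delta> x j)" for x
    using step.hyps by (cases j) (simp_all add: SW_z_def)
  then show ?case using has_leading_form_SW_step[OF H _ step.IH] step.hyps by simp
qed

lemma eventually_SW_step_defined:
  assumes H: "weight_function H (- 1) H2" "H (mat 1) = mat 1"
  shows "\<forall>\<^sub>F x in nhds \<alpha>. SW_step_defined m D F H \<beta> \<delta> x"
proof -
  have "\<forall>\<^sub>F x in nhds \<alpha>. closed_segment x (SW_w F \<beta> x) \<subseteq> D"
    by (intro eventually_closed_segment_subset has_leading_form_tendsto[OF has_leading_form_SW_w])
       (simp_all add: filterlim_ident)
  moreover have "\<forall>\<^sub>F x in nhds \<alpha>. closed_segment (SW_v F \<beta> \<delta> x) (SW_z1 F \<beta> x) \<subseteq> D"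
    by (intro eventually_closed_segment_subset has_leading_form_tendsto[OF has_leading_form_SW_v]
        has_leading_form_tendsto[OF has_leading_form_SW_z1]) simp_all
  moreover have "\<forall>\<^sub>F x in nhds \<alpha>. \<forall>j\<in>{1..m}. SW_z F H \<beta> \<delta> x j \<in> D"
  proof (intro eventually_ball_finite ballI)
    fix j assume j: "j \<in> {1..m}"
    have "((\<lambda>x. SW_z F H \<beta> \<delta> x j) \<longlongrightarrow> \<alpha>) (nhds \<alpha>)"
      by (rule has_leading_form_tendsto[OF has_leading_form_SW_z[OF H]]) (use j in auto)
    then show "\<forall>\<^sub>F x in nhds \<alpha>. SW_z F H \<beta> \<delta> x j \<in> D"
      using open_D \<alpha>_in_D by (rule topological_tendstoD)
  qed simp
  ultimately show ?thesis
    using eventually_invertible_SW_A[of \<beta>] unfolding SW_step_defined_def by eventually_elim simp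
qed

end

lemma SW_eq_funpow: "SW m F H \<beta> \<delta> x k = ((\<lambda>x. SW_z F H \<beta> \<delta> x m) ^^ k) x"
  by (induction k) simp_all

theorem theorem1:
  fixes F :: "real^'n \<Rightarrow> real^'n"
    and H :: "real^'n^'n \<Rightarrow> real^'n^'n"
    and D :: "(real^'n) set"
    and \<alpha> :: "real^'n"
    and H1 H2 \<beta> \<delta> :: real
    and m :: nat
  assumes "1 \<le> m"
    and "open D" and "\<alpha> \<in> D"
    and "C_times_on (2 * m + 1) D F"
    and "F \<alpha> = 0"
    and "invertible (jacobian F (at \<alpha>))"
    and "weight_function H H1 H2"
    and "H (mat 1) = mat 1"
    and "H1 = -1"
    and "\<beta> \<noteq> 0" and "\<delta> \<noteq> 0"
  shows "(\<forall>\<^sub>F x0 in nhds \<alpha>. \<forall>k. SW_step_defined m D F H \<beta> \<delta> (SW m F H \<beta> \<delta> x0 k)) \<and>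
         locally_converges_with_order (SW m F H \<beta> \<delta>) \<alpha> (2 * m)"
proof -
  have "C_times_on 3 D F"
    by (rule C_times_on_le[OF assms(4)]) (use assms(1) in simp)
  then interpret regular_zero F D \<alpha>
    using assms by unfold_locales
  have H: "weight_function H (- 1) H2" "H (mat 1) = mat 1" using assms by simp_all
  let ?\<phi> = "\<lambda>x. SW_z F H \<beta> \<delta> x m"
  obtain K where K: "multilinear_map (2 * m) K"
    "vanishes_to_order \<alpha> (2 * m) (\<lambda>x. ?\<phi> x - \<alpha>)"
    "vanishes_to_order \<alpha> (2 * m + 1) (\<lambda>x. (?\<phi> x - \<alpha>) - K (replicate (2 * m) (x - \<alpha>)))"
    using has_leading_form_SW_z[OF H assms(1)] by (rule has_leading_formE)
  obtain C where C: "\<forall>\<^sub>F x in nhds \<alpha>. norm (?\<phi> x - \<alpha>) \<le> C * norm (x - \<alpha>) ^ (2 * m)"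
    using K(2) vanishes_to_orderE by blast
  obtain B where B: "\<forall>\<^sub>F x in nhds \<alpha>. norm ((?\<phi> x - \<alpha>) - K (replicate (2 * m) (x - \<alpha>)))
      \<le> B * norm (x - \<alpha>) ^ (2 * m + 1)"
    using K(3) vanishes_to_orderE by blast
  \<comment> \<open>All local requirements are bundled into one property of a single iterate, so that one invariant ball
    serves them all, with constants that do not depend on the starting point.\<close>
  note good = eventually_conj[OF eventually_SW_step_defined[OF H] eventually_conj[OF B C]]
  have "2 \<le> 2 * m" using assms(1) by simp
  from iterates_of_superlinear_map[OF K(2) this good, folded SW_eq_funpow]
  have orbit: "\<forall>\<^sub>F x0 in nhds \<alpha>. SW m F H \<beta> \<delta> x0 \<longlonglongrightarrow> \<alpha> \<and>
      (\<forall>k. SW_step_defined m D F H \<beta> \<delta> (SW m F H \<beta> \<delta> x0 k) \<and>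
        norm ((SW m F H \<beta> \<delta> x0 (Suc k) - \<alpha>) - K (replicate (2 * m) (SW m F H \<beta> \<delta> x0 k - \<alpha>)))
          \<le> B * norm (SW m F H \<beta> \<delta> x0 k - \<alpha>) ^ (2 * m + 1) \<and>
        norm (SW m F H \<beta> \<delta> x0 (Suc k) - \<alpha>) \<le> C * norm (SW m F H \<beta> \<delta> x0 k - \<alpha>) ^ (2 * m))"
    by simp
  show ?thesis
    unfolding locally_converges_with_order_def
    by (intro conjI exI[of _ K] exI[of _ B] exI[of _ C] K(1) eventually_mono[OF orbit]) blast+
qed

end
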